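(* Suppose that the collocated residual admits the tensor-train representation $$\rho(\theta)(\overline{i_1\ldots i_d})=\mathsf Y_1(i_1)\cdots\mathsf Y_d(i_d),\qquad \mathsf Y_m(i_m)\in\mathbb R^{q_{m-1}\times q_m},\quad q_0=q_d=1.$$ For every operator term $\beta$ define the mixed interfaces by $$\mathsf L_{<1}^{(\beta,\rho)}=1,\quad \mathsf L_{<m+1}^{(\beta,\rho)}:=\frac1{n_m}\sum_{j_m=1}^{n_m}\big(\mathsf G_m^{(\beta)}(j_m)\big)^\top\mathsf L_{<m}^{(\beta,\rho)}\mathsf Y_m(j_m),$$ $$\mathsf R_{>d}^{(\beta,\rho)}=1,\quad \mathsf R_{>m-1}^{(\beta,\rho)}:=\frac1{n_m}\sum_{j_m=1}^{n_m}\mathsf G_m^{(\beta)}(j_m)\mathsf R_{>m}^{(\beta,\rho)}\mathsf Y_m(j_m)^\top,$$ so that $\mathsf L_{<s}^{(\beta,\rho)}\in\mathbb R^{r_{s-1}\times q_{s-1}}$ and $\mathsf R_{>s}^{(\beta,\rho)}\in\mathbb R^{r_s\times q_s}$. For $i_s=1,\dots,n_s$ set $$\mathsf P_s^{(\beta)}(i_s):=\frac1{n_s}\mathsf L_{<s}^{(\beta,\rho)}\mathsf Y_s(i_s)\big(\mathsf R_{>s}^{(\beta,\rho)}\big)^\top\in\mathbb R^{r_{s-1}\times r_s}.$$ Then the operator-indexed compressed residual $\rho_{\mathrm c,s}^{(\beta)}:=\frac1{N_{\mathcal D}}(\Psi_s^{(\beta)})^\top\rho(\theta)$ satisfies $$\rho_{\mathrm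 c,s}^{(\beta)}\big(\overline{i_s\alpha_{s-1}\alpha_s}\big)=\mathsf P_s^{(\beta)}(i_s)(\alpha_{s-1},\alpha_s).$$
   Context: $\mathcal D=\mathcal D_1\times\cdots\times\mathcal D_d$ with bounded open intervals $\mathcal D_m$; $H_m\hookrightarrow L^2(\mathcal D_m)$ Hilbert spaces; TT ranks $r_0=r_d=1$, $r_m\in\mathbb N$. The tensor-train ansatz is $u_\theta(z)=G_1(z_1;\theta^1)\cdots G_d(z_d;\theta^d)$ with cores $G_m:\mathcal D_m\to\mathbb R^{r_{m-1}\times r_m}$ whose entries lie in $H_m$; $\mathcal A=\sum_{\beta=1}^{R_{\mathcal A}}\mathcal A_1^{(\beta)}\otimes\cdots\otimes\mathcal A_d^{(\beta)}$ with bounded linear $\mathcal A_m^{(\beta)}:H_m\to L^2(\mathcal D_m)$ applied entrywise to cores; $\mathcal A_m^{(\beta)}G_m$ has continuous entries. Factor grids $\{z_{m,1},\dots,z_{m,n_m}\}\subset\mathcal D_m$; $N_{\mathcal D}=\prod_mn_m$; $\mathsf G_m^{(\beta)}(i_m)=(\mathcal A_m^{(\beta)}G_m)(z_{m,i_m})\in\mathbb R^{r_{m-1}\times r_m}$. The collocated residual is $\rho(\theta)(\overline{i_1\ldots i_d})=(\mathcal Au_\theta-f)(z_{1,i_1},\dots,z_{d,i_d})$ for a given source $f$ admitting pointwise evaluation. Index convention: $\overline{i_1\ldots i_k}$ is the lexicographic position of $(i_1,\dots,i_k)$ (leftmost index slowest). With $i_{-s}$ the multi-index $(i_1,\dots,i_d)$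 without $i_s$, $$\mathsf E_s^{(\beta)}(\overline{i_{-s}},\overline{\alpha_{s-1}\alpha_s})=\big[\mathsf G_1^{(\beta)}(i_1)\cdots\mathsf G_{s-1}^{(\beta)}(i_{s-1})\big](1,\alpha_{s-1})\,\big[\mathsf G_{s+1}^{(\beta)}(i_{s+1})\cdots\mathsf G_d^{(\beta)}(i_d)\big](\alpha_s,1)$$ (empty products equal $1$), and $\Psi_s^{(\beta)}\in\mathbb R^{N_{\mathcal D}\times n_sr_{s-1}r_s}$, $\Psi_s^{(\beta)}(\overline{i_1\ldots i_d},\overline{j_s\alpha_{s-1}\alpha_s})=\delta_{i_sj_s}\mathsf E_s^{(\beta)}(\overline{i_{-s}},\overline{\alpha_{s-1}\alpha_s})$. *)

theory Defs
  imports "HOL-Analysis.Lebesgue_Measure" "HOL-Analysis.Function_Topology"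
    "Jordan_Normal_Form.Matrix"
begin

section \<open>Function spaces on the factor domains\<close>

text \<open>Elements of \<open>L\<^sup>2(D)\<close> are represented by square-integrable functions; equality in \<open>L\<^sup>2(D)\<close>
  is equality almost everywhere on \<open>D\<close>.\<close>

definition L2_set :: "real set \<Rightarrow> (real \<Rightarrow> real) set" where
  "L2_set D = {u \<in> borel_measurable (lebesgue_on D). integrable (lebesgue_on D) (\<lambda>x. (u x)\<^sup>2)}"

definition L2_norm_on :: "real set \<Rightarrow> (real \<Rightarrow> real) \<Rightarrow> real" where
  "L2_norm_on D u = sqrt (\<integral>x. (u x)\<^sup>2 \<partial>lebesgue_on D)"

text \<open>A Hilbert space \<open>H\<close> continuously embedded in \<open>L\<^sup>2(D)\<close>: a subspace of \<open>L\<^sup>2(D)\<close> (a set of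
  representatives closed under a.e. equality) that is complete for its own inner product \<open>ip\<close>, with
  norm dominating the \<open>L\<^sup>2\<close> norm. Definiteness of \<open>ip\<close> is understood modulo a.e. equality.\<close>

definition hilbert_in_L2 ::
  "real set \<Rightarrow> (real \<Rightarrow> real) set \<Rightarrow> ((real \<Rightarrow> real) \<Rightarrow> (real \<Rightarrow> real) \<Rightarrow> real) \<Rightarrow> bool" where
  "hilbert_in_L2 D H ip \<longleftrightarrow>
     H \<subseteq> L2_set D \<and>
     (\<forall>u\<in>H. \<forall>v\<in>borel_measurable (lebesgue_on D). (AE x in lebesgue_on D. v x = u x) \<longrightarrow> v \<in> H) \<and>
     (\<lambda>x. 0) \<in> H \<and>
     (\<forall>u\<in>H. \<forall>v\<in>H. (\<lambda>x. u x + v x) \<in> H) \<and>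
     (\<forall>c. \<forall>u\<in>H. (\<lambda>x. c * u x) \<in> H) \<and>
     (\<forall>u\<in>H. \<forall>v\<in>H. ip u v = ip v u) \<and>
     (\<forall>u\<in>H. \<forall>v\<in>H. \<forall>w\<in>H. ip (\<lambda>x. u x + v x) w = ip u w + ip v w) \<and>
     (\<forall>c. \<forall>u\<in>H. \<forall>v\<in>H. ip (\<lambda>x. c * u x) v = c * ip u v) \<and>
     (\<forall>u\<in>H. 0 \<le> ip u u) \<and>
     (\<forall>u\<in>H. ip u u = 0 \<longleftrightarrow> (AE x in lebesgue_on D. u x = 0)) \<and>
     (\<forall>U. (\<forall>k::nat. U k \<in> H) \<and>
          (\<forall>e>0. \<exists>K. \<forall>k\<ge>K. \<forall>l\<ge>K.
             sqrt (ip (\<lambda>x. U k x - U l x) (\<lambda>x. U k x - U l x)) < e) \<longrightarrow>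
          (\<exists>u\<in>H. (\<lambda>k. sqrt (ip (\<lambda>x. U k x - u x) (\<lambda>x. U k x - u x))) \<longlonglongrightarrow> 0)) \<and>
     (\<exists>C. \<forall>u\<in>H. L2_norm_on D u \<le> C * sqrt (ip u u))"

definition bounded_linear_to_L2 ::
  "real set \<Rightarrow> (real \<Rightarrow> real) set \<Rightarrow> ((real \<Rightarrow> real) \<Rightarrow> (real \<Rightarrow> real) \<Rightarrow> real) \<Rightarrow>
   ((real \<Rightarrow> real) \<Rightarrow> (real \<Rightarrow> real)) \<Rightarrow> bool" where
  "bounded_linear_to_L2 D H ip T \<longleftrightarrow>
     (\<forall>u\<in>H. T u \<in> L2_set D) \<and>
     (\<forall>u\<in>H. \<forall>v\<in>H. AE x in lebesgue_on D. T (\<lambda>y. u y + v y) x = T u x + T v x) \<and>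
     (\<forall>c. \<forall>u\<in>H. AE x in lebesgue_on D. T (\<lambda>y. c * u y) x = c * T u x) \<and>
     (\<exists>C. \<forall>u\<in>H. L2_norm_on D (T u) \<le> C * sqrt (ip u u))"

text \<open>Point values of an a.e. class are those of its continuous representative. On an open interval,
  or an open box, that representative is unique.\<close>

definition has_cont_rep :: "'a::topological_space measure \<Rightarrow> ('a \<Rightarrow> real) \<Rightarrow> bool" where
  "has_cont_rep M w \<longleftrightarrow> (\<exists>v. continuous_on (space M) v \<and> (AE x in M. v x = w x))"

definition cont_rep :: "'a::topological_space measure \<Rightarrow> ('a \<Rightarrow> real) \<Rightarrow> 'a \<Rightarrow> real" where
  "cont_rep M w = (SOME v. continuous_on (space M) v \<and> (AE x in M. v x = w x))"


section \<open>Tensor trains and the collocated residual\<close>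

text \<open>\<open>mat_chain r F a k = F (a+1) * \<dots> * F (a+k)\<close>, where \<open>F m\<close> has size \<open>r (m-1) \<times> r m\<close>.\<close>

primrec mat_chain :: "(nat \<Rightarrow> nat) \<Rightarrow> (nat \<Rightarrow> real mat) \<Rightarrow> nat \<Rightarrow> nat \<Rightarrow> real mat" where
  "mat_chain r F a 0 = 1\<^sub>m (r a)"
| "mat_chain r F a (Suc k) = mat_chain r F a k * F (a + Suc k)"

definition tt_fun ::
  "nat \<Rightarrow> (nat \<Rightarrow> nat) \<Rightarrow> (nat \<Rightarrow> real \<Rightarrow> real mat) \<Rightarrow> (nat \<Rightarrow> real) \<Rightarrow> real" where
  "tt_fun d r G x = mat_chain r (\<lambda>m. G m (x m)) 0 d $$ (0, 0)"

abbreviation box_measure :: "nat \<Rightarrow> (nat \<Rightarrow> real set) \<Rightarrow> (nat \<Rightarrow> real) measure" where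
  "box_measure d D \<equiv> PiM {1..d} (\<lambda>m. lebesgue_on (D m))"

text \<open>The operator \<open>T 1 \<otimes> \<dots> \<otimes> T d\<close> on the algebraic tensor product of \<open>H 1, \<dots>, H d\<close>: it sends
  \<open>\<Sum>k. U k 1 \<otimes> \<dots> \<otimes> U k d\<close> to \<open>\<Sum>k. T 1 (U k 1) \<otimes> \<dots> \<otimes> T d (U k d)\<close>. By linearity of the
  \<open>T m\<close> (and Fubini) the image does not, up to null sets, depend on the chosen representation.\<close>

definition tensor_op ::
  "nat \<Rightarrow> (nat \<Rightarrow> real set) \<Rightarrow> (nat \<Rightarrow> (real \<Rightarrow> real) set) \<Rightarrow>
   (nat \<Rightarrow> (real \<Rightarrow> real) \<Rightarrow> (real \<Rightarrow> real)) \<Rightarrow> ((nat \<Rightarrow> real) \<Rightarrow> real) \<Rightarrow> (nat \<Rightarrow> real) \<Rightarrow> real" where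
  "tensor_op d D H T u = (SOME w. \<exists>(K::nat) U.
      (\<forall>k<K. \<forall>m\<in>{1..d}. U k m \<in> H m) \<and>
      (AE x in box_measure d D. u x = (\<Sum>k<K. \<Prod>m\<in>{1..d}. U k m (x m))) \<and>
      w = (\<lambda>x. \<Sum>k<K. \<Prod>m\<in>{1..d}. T m (U k m) (x m)))"

definition sum_tensor_op ::
  "nat \<Rightarrow> (nat \<Rightarrow> real set) \<Rightarrow> (nat \<Rightarrow> (real \<Rightarrow> real) set) \<Rightarrow> nat \<Rightarrow>
   (nat \<Rightarrow> nat \<Rightarrow> (real \<Rightarrow> real) \<Rightarrow> (real \<Rightarrow> real)) \<Rightarrow> ((nat \<Rightarrow> real) \<Rightarrow> real) \<Rightarrow> (nat \<Rightarrow> real) \<Rightarrow> real" where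
  "sum_tensor_op d D H RA A u = (\<lambda>x. \<Sum>\<beta>\<in>{1..RA}. tensor_op d D H (A \<beta>) u x)"

text \<open>Positions are counted from 0. For a multi-index \<open>i\<close> over a finite set \<open>S\<close> of factors,
  \<open>i m < n m\<close>, the position is the mixed-radix number whose digit at the largest \<open>m\<close> varies fastest;
  \<open>lex_digit\<close> is the inverse (see \<open>lex_digit_lex_pos\<close>).\<close>

definition lex_pos :: "nat set \<Rightarrow> (nat \<Rightarrow> nat) \<Rightarrow> (nat \<Rightarrow> nat) \<Rightarrow> nat" where
  "lex_pos S n i = (\<Sum>m\<in>S. i m * (\<Prod>l\<in>{l\<in>S. m < l}. n l))"

definition lex_digit :: "nat set \<Rightarrow> (nat \<Rightarrow> nat) \<Rightarrow> nat \<Rightarrow> nat \<Rightarrow> nat" where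
  "lex_digit S n p m = (p div (\<Prod>l\<in>{l\<in>S. m < l}. n l)) mod n m"

definition residual_vec ::
  "nat \<Rightarrow> (nat \<Rightarrow> real set) \<Rightarrow> (nat \<Rightarrow> (real \<Rightarrow> real) set) \<Rightarrow> nat \<Rightarrow>
   (nat \<Rightarrow> nat \<Rightarrow> (real \<Rightarrow> real) \<Rightarrow> (real \<Rightarrow> real)) \<Rightarrow> (nat \<Rightarrow> nat) \<Rightarrow> (nat \<Rightarrow> real \<Rightarrow> real mat) \<Rightarrow>
   ((nat \<Rightarrow> real) \<Rightarrow> real) \<Rightarrow> (nat \<Rightarrow> nat) \<Rightarrow> (nat \<Rightarrow> nat \<Rightarrow> real) \<Rightarrow> real vec" where
  "residual_vec d D H RA A r G f n z = vec (\<Prod>m\<in>{1..d}. n m) (\<lambda>p.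
     let x = (\<lambda>m\<in>{1..d}. z m (lex_digit {1..d} n p m))
     in cont_rep (box_measure d D) (sum_tensor_op d D H RA A (tt_fun d r G)) x - f x)"


section \<open>Operator-indexed interface matrices\<close>

text \<open>\<open>op_core D r A G z \<beta> m i\<close> is the matrix of values at the grid point \<open>z m i\<close> of the core obtained by
  applying \<open>A \<beta> m\<close> to every entry of \<open>G m\<close>.\<close>

definition op_core ::
  "(nat \<Rightarrow> real set) \<Rightarrow> (nat \<Rightarrow> nat) \<Rightarrow> (nat \<Rightarrow> nat \<Rightarrow> (real \<Rightarrow> real) \<Rightarrow> (real \<Rightarrow> real)) \<Rightarrow>
   (nat \<Rightarrow> real \<Rightarrow> real mat) \<Rightarrow> (nat \<Rightarrow> nat \<Rightarrow> real) \<Rightarrow> nat \<Rightarrow> nat \<Rightarrow> nat \<Rightarrow> real mat" where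
  "op_core D r A G z \<beta> m i = mat (r (m - 1)) (r m) (\<lambda>(a, b).
     cont_rep (lebesgue_on (D m)) (A \<beta> m (\<lambda>y. G m y $$ (a, b))) (z m i))"

text \<open>In the following, \<open>Gb m i\<close> stands for the evaluated cores of one fixed operator term \<open>\<beta>\<close>.
  Rows and columns of the environment matrix \<open>E_mat\<close> and of \<open>Psi_mat\<close> are decoded to multi-indices;
  \<open>E_mat_entry\<close> and \<open>Psi_mat_entry\<close> below give the entries in terms of the encoded indices.\<close>

definition E_mat ::
  "nat \<Rightarrow> (nat \<Rightarrow> nat) \<Rightarrow> (nat \<Rightarrow> nat) \<Rightarrow> (nat \<Rightarrow> nat \<Rightarrow> real mat) \<Rightarrow> nat \<Rightarrow> real mat" where
  "E_mat d n r Gb s = mat (\<Prod>m\<in>{1..d} - {s}. n m) (r (s - 1) * r s) (\<lambda>(p, c).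
     let i = lex_digit ({1..d} - {s}) n p; a = c div r s; b = c mod r s
     in mat_chain r (\<lambda>m. Gb m (i m)) 0 (s - 1) $$ (0, a) *
        mat_chain r (\<lambda>m. Gb m (i m)) s (d - s) $$ (b, 0))"

definition Psi_mat ::
  "nat \<Rightarrow> (nat \<Rightarrow> nat) \<Rightarrow> (nat \<Rightarrow> nat) \<Rightarrow> (nat \<Rightarrow> nat \<Rightarrow> real mat) \<Rightarrow> nat \<Rightarrow> real mat" where
  "Psi_mat d n r Gb s = mat (\<Prod>m\<in>{1..d}. n m) (n s * r (s - 1) * r s) (\<lambda>(p, c).
     let i = lex_digit {1..d} n p; j = c div (r (s - 1) * r s); e = c mod (r (s - 1) * r s)
     in if i s = j then E_mat d n r Gb s $$ (lex_pos ({1..d} - {s}) n i, e) else 0)"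

definition compressed_residual ::
  "nat \<Rightarrow> (nat \<Rightarrow> nat) \<Rightarrow> (nat \<Rightarrow> nat) \<Rightarrow> (nat \<Rightarrow> nat \<Rightarrow> real mat) \<Rightarrow> nat \<Rightarrow> real vec \<Rightarrow> real vec" where
  "compressed_residual d n r Gb s \<rho> =
     (1 / real (\<Prod>m\<in>{1..d}. n m)) \<cdot>\<^sub>v (transpose_mat (Psi_mat d n r Gb s) *\<^sub>v \<rho>)"


section \<open>Mixed interfaces\<close>

definition mat_sum :: "nat \<Rightarrow> nat \<Rightarrow> (nat \<Rightarrow> real mat) \<Rightarrow> nat set \<Rightarrow> real mat" where
  "mat_sum nr nc F J = mat nr nc (\<lambda>(a, b). \<Sum>j\<in>J. F j $$ (a, b))"

text \<open>\<open>left_interface \<dots> m\<close> is the interface with subscript \<open><m+1\<close>, and \<open>right_interface \<dots> m\<close> the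
  one with subscript \<open>>m\<close>.\<close>

primrec left_interface ::
  "(nat \<Rightarrow> nat) \<Rightarrow> (nat \<Rightarrow> nat) \<Rightarrow> (nat \<Rightarrow> nat) \<Rightarrow> (nat \<Rightarrow> nat \<Rightarrow> real mat) \<Rightarrow>
   (nat \<Rightarrow> nat \<Rightarrow> real mat) \<Rightarrow> nat \<Rightarrow> real mat" where
  "left_interface n r q Gb Y 0 = 1\<^sub>m 1"
| "left_interface n r q Gb Y (Suc m) = (1 / real (n (Suc m))) \<cdot>\<^sub>m
     mat_sum (r (Suc m)) (q (Suc m))
       (\<lambda>j. transpose_mat (Gb (Suc m) j) * left_interface n r q Gb Y m * Y (Suc m) j) {..<n (Suc m)}"

function right_interface ::
  "nat \<Rightarrow> (nat \<Rightarrow> nat) \<Rightarrow> (nat \<Rightarrow> nat) \<Rightarrow> (nat \<Rightarrow> nat) \<Rightarrow> (nat \<Rightarrow> nat \<Rightarrow> real mat) \<Rightarrow>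
   (nat \<Rightarrow> nat \<Rightarrow> real mat) \<Rightarrow> nat \<Rightarrow> real mat" where
  "right_interface d n r q Gb Y m =
     (if d \<le> m then 1\<^sub>m 1
      else (1 / real (n (Suc m))) \<cdot>\<^sub>m
        mat_sum (r m) (q m)
          (\<lambda>j. Gb (Suc m) j * right_interface d n r q Gb Y (Suc m) * transpose_mat (Y (Suc m) j))
          {..<n (Suc m)})"
  by pat_completeness auto
termination by (relation "Wellfounded.measure (\<lambda>(d, n, r, q, Gb, Y, m). d - m)") auto

declare right_interface.simps [simp del]

definition P_mat ::
  "nat \<Rightarrow> (nat \<Rightarrow> nat) \<Rightarrow> (nat \<Rightarrow> nat) \<Rightarrow> (nat \<Rightarrow> nat) \<Rightarrow> (nat \<Rightarrow> nat \<Rightarrow> real mat) \<Rightarrow>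
   (nat \<Rightarrow> nat \<Rightarrow> real mat) \<Rightarrow> nat \<Rightarrow> nat \<Rightarrow> real mat" where
  "P_mat d n r q Gb Y s i = (1 / real (n s)) \<cdot>\<^sub>m
     (left_interface n r q Gb Y (s - 1) * Y s i * transpose_mat (right_interface d n r q Gb Y s))"


section \<open>Index bookkeeping\<close>

lemma lex_pos_insert_max:
  assumes "finite S" "\<forall>l\<in>S. l < b"
  shows "lex_pos (insert b S) n i = lex_pos S n i * n b + i b"
proof -
  have nb: "b \<notin> S" using assms(2) by blast
  have top: "{l \<in> insert b S. b < l} = {}" using assms(2) by auto
  have "(\<Prod>l\<in>{l \<in> insert b S. m < l}. n l) = n b * (\<Prod>l\<in>{l \<in> S. m < l}. n l)" if "m \<in> S" for m
  proof -
    have "{l \<in> insert b S. m < l} = insert b {l \<in> S. m < l}" using that assms(2) by auto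
    then show ?thesis using nb assms(1) by simp
  qed
  then have "(\<Sum>m\<in>S. i m * (\<Prod>l\<in>{l \<in> insert b S. m < l}. n l)) = lex_pos S n i * n b"
    by (simp add: lex_pos_def sum_distrib_left sum_distrib_right mult.assoc mult.commute mult.left_commute)
  then show ?thesis
    using nb assms(1) unfolding lex_pos_def[of "insert b S"]
    by (subst sum.insert) (simp_all only: top prod.empty mult_1_right add.commute not_False_eq_True)
qed

lemma lex_pos_less:
  assumes "finite S" "\<forall>m\<in>S. i m < n m"
  shows "lex_pos S n i < (\<Prod>m\<in>S. n m)"
  using assms
proof (induction S rule: finite_linorder_max_induct)
  case empty
  then show ?case by (simp add: lex_pos_def)
next
  case (insert b A)
  have "lex_pos A n i + 1 \<le> (\<Prod>m\<in>A. n m)" using insert by auto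
  then have "(lex_pos A n i + 1) * n b \<le> (\<Prod>m\<in>A. n m) * n b" by (rule mult_right_mono) simp
  moreover have "i b < n b" "b \<notin> A" using insert by auto
  ultimately show ?case
    using insert.hyps by (simp add: lex_pos_insert_max mult.commute)
qed

lemma lex_digit_lex_pos:
  assumes "finite S" "\<forall>m\<in>S. i m < n m" "m \<in> S"
  shows "lex_digit S n (lex_pos S n i) m = i m"
  using assms
proof (induction S rule: finite_linorder_max_induct)
  case (insert b A)
  have ib: "i b < n b" and nb: "b \<notin> A" using insert by auto
  show ?case
  proof (cases "m = b")
    case True
    have "{l \<in> insert b A. b < l} = {}" using insert.hyps by auto
    then show ?thesis using ib insert.hyps
      unfolding True lex_digit_def lex_pos_insert_max[OF insert.hyps(1,2)]
      by (simp only: prod.empty) simp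
  next
    case False
    then have mA: "m \<in> A" using insert by auto
    have "{l \<in> insert b A. m < l} = insert b {l \<in> A. m < l}" using mA insert.hyps by auto
    then have "(\<Prod>l\<in>{l \<in> insert b A. m < l}. n l) = n b * (\<Prod>l\<in>{l \<in> A. m < l}. n l)"
      using nb insert.hyps by simp
    then have "lex_digit (insert b A) n (lex_pos (insert b A) n i) m = lex_digit A n (lex_pos A n i) m"
      using ib unfolding lex_digit_def lex_pos_insert_max[OF insert.hyps(1,2)]
      by (simp only: div_mult2_eq) simp
    then show ?thesis using insert mA by simp
  qed
qed simp

lemma mat_chain_cong:
  "(\<And>m. a < m \<Longrightarrow> m \<le> a + k \<Longrightarrow> F m = F' m) \<Longrightarrow> mat_chain r F a k = mat_chain r F' a k"
  by (induction k) auto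

lemma pair_index_less: "a < (k::nat) \<Longrightarrow> b < l \<Longrightarrow> a * l + b < k * l"
proof -
  assume "a < k" "b < l"
  then have "(a + 1) * l \<le> k * l" by (intro mult_right_mono) auto
  with \<open>b < l\<close> show ?thesis by simp
qed

lemma pair_index_div_mod:
  assumes "b < (l::nat)"
  shows "(a * l + b) div l = a" "(a * l + b) mod l = b"
  using assms by auto

lemma E_mat_entry:
  assumes s: "s \<in> {1..d}" and i: "\<forall>m\<in>{1..d} - {s}. i m < n m" and a: "a < r (s - 1)" and b: "b < r s"
  shows "E_mat d n r Gb s $$ (lex_pos ({1..d} - {s}) n i, a * r s + b) =
    mat_chain r (\<lambda>m. Gb m (i m)) 0 (s - 1) $$ (0, a) * mat_chain r (\<lambda>m. Gb m (i m)) s (d - s) $$ (b, 0)"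
proof -
  let ?i = "lex_digit ({1..d} - {s}) n (lex_pos ({1..d} - {s}) n i)"
  have "?i m = i m" if "1 \<le> m" "m \<le> d" "m \<noteq> s" for m
    using lex_digit_lex_pos[of "{1..d} - {s}" i n m] i that by auto
  note ii = this
  have "mat_chain r (\<lambda>m. Gb m (?i m)) 0 (s - 1) = mat_chain r (\<lambda>m. Gb m (i m)) 0 (s - 1)"
    and "mat_chain r (\<lambda>m. Gb m (?i m)) s (d - s) = mat_chain r (\<lambda>m. Gb m (i m)) s (d - s)"
    using s by (intro mat_chain_cong; subst ii; force)+
  then show ?thesis
    using lex_pos_less[of "{1..d} - {s}" i n] i pair_index_less[OF a b] b by (simp add: E_mat_def)
qed

lemma Psi_mat_entry:
  assumes s: "s \<in> {1..d}" and i: "\<forall>m\<in>{1..d}. i m < n m"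
    and j: "j < n s" and a: "a < r (s - 1)" and b: "b < r s"
  shows "Psi_mat d n r Gb s $$ (lex_pos {1..d} n i, (j * r (s - 1) + a) * r s + b) =
    (if i s = j then E_mat d n r Gb s $$ (lex_pos ({1..d} - {s}) n i, a * r s + b) else 0)"
proof -
  let ?i = "lex_digit {1..d} n (lex_pos {1..d} n i)"
  have ii: "?i m = i m" if "m \<in> {1..d}" for m
    using lex_digit_lex_pos[of "{1..d}" i n m] i that by blast
  have pp: "lex_pos ({1..d} - {s}) n ?i = lex_pos ({1..d} - {s}) n i"
    unfolding lex_pos_def[of "{1..d} - {s}"] using ii by (intro sum.cong) auto
  have e: "a * r s + b < r (s - 1) * r s" using pair_index_less[OF a b] .
  have c: "(j * r (s - 1) + a) * r s + b = j * (r (s - 1) * r s) + (a * r s + b)"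
    by (simp add: algebra_simps)
  have "(j * r (s - 1) + a) * r s + b < n s * r (s - 1) * r s"
    unfolding c using pair_index_less[OF j e] by (simp add: mult.assoc)
  moreover have "((j * r (s - 1) + a) * r s + b) div (r (s - 1) * r s) = j"
    and "((j * r (s - 1) + a) * r s + b) mod (r (s - 1) * r s) = a * r s + b"
    unfolding c by (rule pair_index_div_mod[OF e])+
  ultimately show ?thesis
    using lex_pos_less[of "{1..d}" i n] i ii[OF s] pp by (simp add: Psi_mat_def Let_def)
qed

lemma residual_vec_entry:
  assumes i: "\<forall>m\<in>{1..d}. i m < n m"
  shows "residual_vec d D H RA A r G f n z $ lex_pos {1..d} n i =
    cont_rep (box_measure d D) (sum_tensor_op d D H RA A (tt_fun d r G)) (\<lambda>m\<in>{1..d}. z m (i m)) -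
    f (\<lambda>m\<in>{1..d}. z m (i m))"
proof -
  have *: "(\<lambda>m\<in>{1..d}. z m (lex_digit {1..d} n (lex_pos {1..d} n i) m)) = (\<lambda>m\<in>{1..d}. z m (i m))"
    by (rule restrict_ext) (simp only: lex_digit_lex_pos[OF finite_atLeastAtMost i])
  show ?thesis
    unfolding residual_vec_def index_vec[OF lex_pos_less[OF finite_atLeastAtMost i]] Let_def * ..
qed

end

theory Submission
  imports Defs
begin

text \<open>Averaging over the grid factorizes. Expanding the recursions, \<open>left_interface\<close> and
  \<open>right_interface\<close> are grid averages of products of an operator core chain with a residual chain
  over the factors before and after \<open>s\<close>. In \<open>\<Psi>\<^sup>T \<rho>\<close> the Kronecker delta freezes \<open>i\<^sub>s\<close>; writing \<open>\<rho>\<close> as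
  left chain times \<open>Y s\<close> times right chain, the remaining sum over \<open>i\<^sub>-\<^sub>s\<close> splits into these two averages.\<close>

section \<open>Sums over multi-indices\<close>

abbreviation multi_idx :: "nat set \<Rightarrow> (nat \<Rightarrow> nat) \<Rightarrow> (nat \<Rightarrow> nat) set" where
  "multi_idx S n \<equiv> PiE S (\<lambda>m. {..<n m})"

lemma finite_multi_idx: "finite S \<Longrightarrow> finite (multi_idx S n)"
  by (intro finite_PiE) auto

text \<open>An extensional multi-index on \<open>insert b S\<close> is the same thing as a digit at
  \<open>b\<close> paired with one on \<open>S\<close>. This is used both to append a factor in the
  interface recursions and to isolate the digit that the Kronecker delta freezes.\<close>

lemma sum_multi_idx_insert:
  fixes F :: "(nat \<Rightarrow> nat) \<Rightarrow> 'a::comm_monoid_add"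
  assumes "finite S" "b \<notin> S"
  shows "(\<Sum>i\<in>multi_idx (insert b S) n. F i) = (\<Sum>j<n b. \<Sum>i\<in>multi_idx S n. F (i(b := j)))"
proof -
  have "inj_on (\<lambda>(j, i). i(b := j)) ({..<n b} \<times> multi_idx S n)"
    using inj_combinator[OF assms(2), of "\<lambda>m. {..<n m}"] by simp
  then have "(\<Sum>i\<in>multi_idx (insert b S) n. F i)
      = (\<Sum>(j, i)\<in>{..<n b} \<times> multi_idx S n. F (i(b := j)))"
    unfolding PiE_insert_eq by (subst sum.reindex) (auto intro!: sum.cong)
  then show ?thesis by (simp add: sum.cartesian_product)
qed

text \<open>A finite Fubini theorem. Dependence on \<open>S\<close> or \<open>T\<close> alone is
  expressed by congruence hypotheses rather than by restriction, so that matrix chains, which are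
  written as functions of the whole multi-index, can be inserted directly. The induction moves the
  digits of \<open>T\<close> out one at a time.\<close>

lemma sum_multi_idx_union:
  fixes F K :: "(nat \<Rightarrow> nat) \<Rightarrow> 'a::comm_semiring_0"
  assumes "finite S" "finite T" "S \<inter> T = {}"
    and "\<And>i i'. (\<And>m. m \<in> S \<Longrightarrow> i m = i' m) \<Longrightarrow> F i = F i'"
    and "\<And>i i'. (\<And>m. m \<in> T \<Longrightarrow> i m = i' m) \<Longrightarrow> K i = K i'"
  shows "(\<Sum>i\<in>multi_idx (S \<union> T) n. F i * K i)
    = (\<Sum>i\<in>multi_idx S n. F i) * (\<Sum>i\<in>multi_idx T n. K i)"
  using assms(2,3,5)
proof (induction T arbitrary: K rule: finite_induct)
  case empty
  \<comment> \<open>With no digits to depend on, \<open>K\<close> is constant; the chosen argument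
    is an arbitrary representative.\<close>
  have K: "K i = K (\<lambda>_. undefined)" for i by (rule empty) simp
  have "(\<Sum>i\<in>multi_idx S n. F i * K i) = (\<Sum>i\<in>multi_idx S n. F i * K (\<lambda>_. undefined))"
    by (rule sum.cong[OF refl]) (subst K, rule refl)
  then show ?case by (simp add: sum_distrib_right)
next
  case (insert b T)
  have b: "b \<notin> S \<union> T" using insert.hyps(2) insert.prems(1) by auto
  have F: "F (i(b := j)) = F i" for i j using b by (intro assms(4)) auto
  \<comment> \<open>The induction hypothesis is applied to \<open>K\<close> with digit
    \<open>b\<close> frozen at \<open>j\<close>, which is why \<open>K\<close> is generalized in the
    induction.\<close>
  have IH: "(\<Sum>i\<in>multi_idx (S \<union> T) n. F i * K (i(b := j)))
      = (\<Sum>i\<in>multi_idx S n. F i) * (\<Sum>i\<in>multi_idx T n. K (i(b := j)))" for j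
  proof (rule insert.IH)
    show "S \<inter> T = {}" using insert.prems(1) by auto
    show "K (i(b := j)) = K (i'(b := j))" if "\<And>m. m \<in> T \<Longrightarrow> i m = i' m" for i i'
      by (rule insert.prems(2)) (use that in auto)
  qed
  have "(\<Sum>i\<in>multi_idx (S \<union> insert b T) n. F i * K i)
      = (\<Sum>j<n b. \<Sum>i\<in>multi_idx (S \<union> T) n. F i * K (i(b := j)))"
    using b assms(1) insert.hyps(1) by (simp add: sum_multi_idx_insert F)
  also have "\<dots> = (\<Sum>i\<in>multi_idx S n. F i) * (\<Sum>i\<in>multi_idx (insert b T) n. K i)"
    using insert.hyps by (simp add: IH sum_multi_idx_insert sum_distrib_left)
  finally show ?case .
qed

text \<open>Injectivity holds because \<open>lex_digit\<close> recovers every digit. This bijection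
  turns a sum over vector positions into a sum over multi-indices.\<close>

lemma bij_betw_lex_pos:
  assumes "finite S"
  shows "bij_betw (lex_pos S n) (multi_idx S n) {..<\<Prod>m\<in>S. n m}"
proof -
  have less: "lex_pos S n i < (\<Prod>m\<in>S. n m)" if "i \<in> multi_idx S n" for i
    using lex_pos_less[OF assms, of i n] that by (auto simp: PiE_iff)
  have inj: "inj_on (lex_pos S n) (multi_idx S n)"
  proof (rule inj_onI)
    fix i i' assume i: "i \<in> multi_idx S n" "i' \<in> multi_idx S n" and eq: "lex_pos S n i = lex_pos S n i'"
    show "i = i'"
    proof (rule PiE_ext[OF i])
      fix m assume "m \<in> S"
      then show "i m = i' m"
        using lex_digit_lex_pos[OF assms, of i n m] lex_digit_lex_pos[OF assms, of i' n m] i eq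
        by (auto simp: PiE_iff)
    qed
  qed
  \<comment> \<open>Surjectivity by counting: domain and target are finite sets with the same
    product of the \<open>n m\<close> as cardinality.\<close>
  have "card (lex_pos S n ` multi_idx S n) = card {..<\<Prod>m\<in>S. n m}"
    using assms by (simp add: card_image[OF inj] card_PiE)
  moreover have "lex_pos S n ` multi_idx S n \<subseteq> {..<\<Prod>m\<in>S. n m}" using less by auto
  ultimately show ?thesis
    unfolding bij_betw_def using inj card_subset_eq[OF finite_lessThan] by blast
qed


section \<open>Matrix chains and interfaces\<close>

lemma index_mult_mat_sum:
  assumes "A \<in> carrier_mat k l" "B \<in> carrier_mat l m" "a < k" "b < m"
  shows "(A * B) $$ (a, b) = (\<Sum>x<l. A $$ (a, x) * B $$ (x, b))"
  using assms by (auto simp: scalar_prod_def atLeast0LessThan intro!: sum.cong)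

lemma index_mult_mat_sum3:
  fixes A B C :: "'a::comm_semiring_0 mat"
  assumes "A \<in> carrier_mat k l" "B \<in> carrier_mat l m" "C \<in> carrier_mat m p" "a < k" "b < p"
  shows "(A * B * C) $$ (a, b) = (\<Sum>x<l. \<Sum>y<m. A $$ (a, x) * B $$ (x, y) * C $$ (y, b))"
proof -
  have "(A * B * C) $$ (a, b) = (\<Sum>y<m. (\<Sum>x<l. A $$ (a, x) * B $$ (x, y)) * C $$ (y, b))"
    using assms by (subst index_mult_mat_sum[of "A * B" k m C p])
      (auto simp: index_mult_mat_sum[of A k l B m] simp del: index_mult_mat)
  also have "\<dots> = (\<Sum>x<l. \<Sum>y<m. A $$ (a, x) * B $$ (x, y) * C $$ (y, b))"
    by (subst sum.swap) (simp add: sum_distrib_right)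
  finally show ?thesis .
qed

text \<open>The end index \<open>c\<close> is kept separate from \<open>a + k\<close> so that the
  rule matches however the last rank is written.\<close>

lemma mat_chain_carrier:
  assumes "\<And>m. a < m \<Longrightarrow> m \<le> a + k \<Longrightarrow> F m \<in> carrier_mat (r (m - 1)) (r m)"
    and "c = a + k"
  shows "mat_chain r F a k \<in> carrier_mat (r a) (r c)"
  using assms(1) unfolding assms(2)
proof (induction k)
  case (Suc k)
  have "F (a + Suc k) \<in> carrier_mat (r (a + k)) (r (a + Suc k))" using Suc.prems[of "a + Suc k"] by simp
  then show ?case using Suc by (auto intro!: mult_carrier_mat)
qed simp

lemma mat_chain_add:
  assumes "\<And>m. a < m \<Longrightarrow> m \<le> a + k + l \<Longrightarrow> F m \<in> carrier_mat (r (m - 1)) (r m)"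
  shows "mat_chain r F a (k + l) = mat_chain r F a k * mat_chain r F (a + k) l"
  using assms
proof (induction l)
  case 0
  then show ?case using mat_chain_carrier[of a k F r "a + k"] by simp
next
  case (Suc l)
  have 1: "F (a + k + Suc l) \<in> carrier_mat (r (a + k + l)) (r (a + k + Suc l))"
    using Suc.prems[of "a + k + Suc l"] by simp
  have 2: "mat_chain r F a k \<in> carrier_mat (r a) (r (a + k))"
    "mat_chain r F (a + k) l \<in> carrier_mat (r (a + k)) (r (a + k + l))"
    using Suc.prems by (auto intro!: mat_chain_carrier)
  show ?case
    using Suc.IH[OF Suc.prems] assoc_mult_mat[OF 2 1] by (simp add: add.assoc)
qed

text \<open>\<open>mat_chain\<close> grows on the right, whereas the recursion for the right
  interface prepends a core on the left. Splitting the chain after one factor reconciles the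
  two.\<close>

lemma mat_chain_Suc_left:
  assumes "\<And>m. a < m \<Longrightarrow> m \<le> a + Suc k \<Longrightarrow> F m \<in> carrier_mat (r (m - 1)) (r m)"
  shows "mat_chain r F a (Suc k) = F (Suc a) * mat_chain r F (Suc a) k"
proof -
  have "F (Suc a) \<in> carrier_mat (r a) (r (Suc a))" using assms[of "Suc a"] by simp
  then show ?thesis using mat_chain_add[of a 1 k F r] assms by simp
qed

section \<open>Interfaces as grid averages of products of two chains\<close>

lemma left_interface_carrier:
  assumes "r 0 = 1" "q 0 = 1"
  shows "left_interface n r q Gb Y k \<in> carrier_mat (r k) (q k)"
  using assms by (cases k) (auto simp: mat_sum_def)

lemma right_interface_carrier:
  assumes "r d = 1" "q d = 1" "m \<le> d"
  shows "right_interface d n r q Gb Y m \<in> carrier_mat (r m) (q m)"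
  using assms by (subst right_interface.simps) (auto simp: mat_sum_def)

text \<open>Induction on \<open>k\<close>: the recursion extends the operator chain and the residual
  chain by their cores at the same grid index, and averaging over that index adds one digit to the
  multi-index. Row 0 is the only row of a leading chain, since \<open>r 0 = q 0 = 1\<close>.\<close>

lemma left_interface_entry:
  assumes "r 0 = 1" "q 0 = 1"
    and "\<And>m j. 1 \<le> m \<Longrightarrow> m \<le> k \<Longrightarrow> j < n m \<Longrightarrow> Gb m j \<in> carrier_mat (r (m - 1)) (r m)"
    and "\<And>m j. 1 \<le> m \<Longrightarrow> m \<le> k \<Longrightarrow> j < n m \<Longrightarrow> Y m j \<in> carrier_mat (q (m - 1)) (q m)"
    and "a < r k" "x < q k"
  shows "left_interface n r q Gb Y k $$ (a, x) =
    (\<Sum>i\<in>multi_idx {1..k} n. mat_chain r (\<lambda>m. Gb m (i m)) 0 k $$ (0, a) *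
      mat_chain q (\<lambda>m. Y m (i m)) 0 k $$ (0, x)) / real (\<Prod>m\<in>{1..k}. n m)"
  using assms(3-)
proof (induction k arbitrary: a x)
  case 0
  then show ?case using assms(1,2) by simp
next
  case (Suc k)
  let ?L = "left_interface n r q Gb Y k" and ?N = "real (\<Prod>m\<in>{1..k}. n m)"
  let ?g = "\<lambda>i. mat_chain r (\<lambda>m. Gb m (i m)) 0 k" and ?y = "\<lambda>i. mat_chain q (\<lambda>m. Y m (i m)) 0 k"
  have dG: "Gb (Suc k) j \<in> carrier_mat (r k) (r (Suc k))" if "j < n (Suc k)" for j
    using Suc.prems(1)[of "Suc k" j] that by simp
  have dY: "Y (Suc k) j \<in> carrier_mat (q k) (q (Suc k))" if "j < n (Suc k)" for j
    using Suc.prems(2)[of "Suc k" j] that by simp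
  have L: "?L \<in> carrier_mat (r k) (q k)" by (rule left_interface_carrier[where r = r and q = q, OF assms(1,2)])
  have IH: "?L $$ (a', x') = (\<Sum>i\<in>multi_idx {1..k} n. ?g i $$ (0, a') * ?y i $$ (0, x')) / ?N"
    if "a' < r k" "x' < q k" for a' x' using that Suc.prems by (intro Suc.IH) auto
  have step: "(transpose_mat (Gb (Suc k) j) * ?L * Y (Suc k) j) $$ (a, x) =
      (\<Sum>i\<in>multi_idx {1..k} n. mat_chain r (\<lambda>m. Gb m ((i(Suc k := j)) m)) 0 (Suc k) $$ (0, a) *
        mat_chain q (\<lambda>m. Y m ((i(Suc k := j)) m)) 0 (Suc k) $$ (0, x)) / ?N"
    if j: "j < n (Suc k)" for j
  proof -
    \<comment> \<open>Each extended chain is a row vector times the new core, hence a sum over one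
      bond index; the product of the two is a double sum.\<close>
    have "mat_chain r (\<lambda>m. Gb m ((i(Suc k := j)) m)) 0 (Suc k) $$ (0, a) *
        mat_chain q (\<lambda>m. Y m ((i(Suc k := j)) m)) 0 (Suc k) $$ (0, x) =
        (\<Sum>a'<r k. \<Sum>x'<q k. Gb (Suc k) j $$ (a', a) * (?g i $$ (0, a') * ?y i $$ (0, x')) * Y (Suc k) j $$ (x', x))"
      if i: "i \<in> multi_idx {1..k} n" for i
    proof -
      have i': "i m < n m" if "1 \<le> m" "m \<le> k" for m using i that by (auto simp: PiE_iff)
      have gc: "mat_chain r (\<lambda>m. Gb m ((i(Suc k := j)) m)) 0 k = ?g i"
        "mat_chain q (\<lambda>m. Y m ((i(Suc k := j)) m)) 0 k = ?y i"
        by (rule mat_chain_cong; simp)+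
      have "?g i \<in> carrier_mat (r 0) (r (0 + k))" "?y i \<in> carrier_mat (q 0) (q (0 + k))"
        using Suc.prems i' by (auto intro!: mat_chain_carrier)
      then have c: "?g i \<in> carrier_mat 1 (r k)" "?y i \<in> carrier_mat 1 (q k)" using assms(1,2) by auto
      show ?thesis
        unfolding mat_chain.simps gc
        using index_mult_mat_sum[OF c(1) dG[OF j], of 0 a] index_mult_mat_sum[OF c(2) dY[OF j], of 0 x] Suc.prems
        by (simp add: sum_product mult_ac)
    qed
    then have "(\<Sum>i\<in>multi_idx {1..k} n. mat_chain r (\<lambda>m. Gb m ((i(Suc k := j)) m)) 0 (Suc k) $$ (0, a) *
        mat_chain q (\<lambda>m. Y m ((i(Suc k := j)) m)) 0 (Suc k) $$ (0, x)) / ?N =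
        (\<Sum>i\<in>multi_idx {1..k} n. \<Sum>a'<r k. \<Sum>x'<q k.
          Gb (Suc k) j $$ (a', a) * (?g i $$ (0, a') * ?y i $$ (0, x')) * Y (Suc k) j $$ (x', x)) / ?N"
      by (intro arg_cong2[where f = "(/)"] sum.cong refl) auto
    \<comment> \<open>The two swaps bring the sum over grid indices innermost, where the induction
      hypothesis recognizes an entry of the previous interface.\<close>
    also have "\<dots> = (\<Sum>a'<r k. \<Sum>x'<q k. Gb (Suc k) j $$ (a', a) *
        (\<Sum>i\<in>multi_idx {1..k} n. ?g i $$ (0, a') * ?y i $$ (0, x')) * Y (Suc k) j $$ (x', x)) / ?N"
      by (subst sum.swap, intro arg_cong2[where f = "(/)"] sum.cong refl, subst sum.swap)
        (simp add: sum_distrib_left sum_distrib_right)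
    also have "\<dots> = (\<Sum>a'<r k. \<Sum>x'<q k. Gb (Suc k) j $$ (a', a) * ?L $$ (a', x') * Y (Suc k) j $$ (x', x))"
      by (simp add: IH sum_divide_distrib sum_distrib_left sum_distrib_right)
    also have "\<dots> = (transpose_mat (Gb (Suc k) j) * ?L * Y (Suc k) j) $$ (a, x)"
      using dG[OF j] Suc.prems(3,4)
      by (subst index_mult_mat_sum3[OF _ L dY[OF j], where k = "r (Suc k)"]) simp_all
    finally show ?thesis by (rule sym)
  qed
  \<comment> \<open>The outer average over \<open>j\<close> supplies the last digit of the
    multi-index and the last factor of the normalization.\<close>
  have ins: "{1..Suc k} = insert (Suc k) {1..k}" by auto
  show ?case
    using Suc.prems(3,4) unfolding ins
    by (subst sum_multi_idx_insert) (simp_all add: mat_sum_def step sum_divide_distrib mult.commute del: mat_chain.simps)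
qed

text \<open>The mirror image of the left case. The induction runs downwards from \<open>d\<close>,
  like the recursion, and column 0 is the only column of a trailing chain, since
  \<open>r d = q d = 1\<close>.\<close>

lemma right_interface_entry:
  assumes "r d = 1" "q d = 1"
    and "\<And>m j. 1 \<le> m \<Longrightarrow> m \<le> d \<Longrightarrow> j < n m \<Longrightarrow> Gb m j \<in> carrier_mat (r (m - 1)) (r m)"
    and "\<And>m j. 1 \<le> m \<Longrightarrow> m \<le> d \<Longrightarrow> j < n m \<Longrightarrow> Y m j \<in> carrier_mat (q (m - 1)) (q m)"
    and "k \<le> d" "a < r k" "x < q k"
  shows "right_interface d n r q Gb Y k $$ (a, x) =
    (\<Sum>i\<in>multi_idx {k<..d} n. mat_chain r (\<lambda>m. Gb m (i m)) k (d - k) $$ (a, 0) *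
      mat_chain q (\<lambda>m. Y m (i m)) k (d - k) $$ (x, 0)) / real (\<Prod>m\<in>{k<..d}. n m)"
  using assms(5-)
proof (induction k arbitrary: a x rule: inc_induct)
  case base
  then show ?case using assms(1,2) by (subst right_interface.simps) simp
next
  case (step k)
  let ?R = "right_interface d n r q Gb Y (Suc k)" and ?N = "real (\<Prod>m\<in>{Suc k<..d}. n m)"
  let ?g = "\<lambda>i. mat_chain r (\<lambda>m. Gb m (i m)) (Suc k) (d - Suc k)"
  let ?y = "\<lambda>i. mat_chain q (\<lambda>m. Y m (i m)) (Suc k) (d - Suc k)"
  let ?I = "multi_idx {Suc k<..d} n"
  have dG: "Gb (Suc k) j \<in> carrier_mat (r k) (r (Suc k))" if "j < n (Suc k)" for j
    using assms(3)[of "Suc k" j] step.hyps that by simp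
  have dY: "Y (Suc k) j \<in> carrier_mat (q k) (q (Suc k))" if "j < n (Suc k)" for j
    using assms(4)[of "Suc k" j] step.hyps that by simp
  have R: "?R \<in> carrier_mat (r (Suc k)) (q (Suc k))"
    using step.hyps by (intro right_interface_carrier[where r = r and q = q, OF assms(1,2)]) simp
  have IH: "?R $$ (a', x') = (\<Sum>i\<in>?I. ?g i $$ (a', 0) * ?y i $$ (x', 0)) / ?N"
    if "a' < r (Suc k)" "x' < q (Suc k)" for a' x' using that by (rule step.IH)
  \<comment> \<open>Exposes a successor length so that the first core of the chain can be split
    off.\<close>
  have dk: "d - k = Suc (d - Suc k)" using step.hyps by simp
  have main: "(Gb (Suc k) j * ?R * transpose_mat (Y (Suc k) j)) $$ (a, x) =
      (\<Sum>i\<in>?I. mat_chain r (\<lambda>m. Gb m ((i(Suc k := j)) m)) k (d - k) $$ (a, 0) *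
        mat_chain q (\<lambda>m. Y m ((i(Suc k := j)) m)) k (d - k) $$ (x, 0)) / ?N"
    if j: "j < n (Suc k)" for j
  proof -
    have "mat_chain r (\<lambda>m. Gb m ((i(Suc k := j)) m)) k (d - k) $$ (a, 0) *
        mat_chain q (\<lambda>m. Y m ((i(Suc k := j)) m)) k (d - k) $$ (x, 0) =
        (\<Sum>a'<r (Suc k). \<Sum>x'<q (Suc k). Gb (Suc k) j $$ (a, a') * (?g i $$ (a', 0) * ?y i $$ (x', 0)) * Y (Suc k) j $$ (x, x'))"
      if i: "i \<in> ?I" for i
    proof -
      have i': "i m < n m" if "Suc k < m" "m \<le> d" for m using i that by (auto simp: PiE_iff)
      have gc: "mat_chain r (\<lambda>m. Gb m ((i(Suc k := j)) m)) (Suc k) (d - Suc k) = ?g i"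
        "mat_chain q (\<lambda>m. Y m ((i(Suc k := j)) m)) (Suc k) (d - Suc k) = ?y i"
        by (rule mat_chain_cong; simp)+
      \<comment> \<open>The sizes of the cores are known only at admissible grid indices, so the
        extended multi-index has to be checked at \<open>Suc k\<close> as well.\<close>
      have le: "(i(Suc k := j)) m < n m" if "k < m" "m \<le> d" for m
        using that i'[of m] j by (cases "m = Suc k") auto
      have cGb: "Gb m ((i(Suc k := j)) m) \<in> carrier_mat (r (m - 1)) (r m)"
        and cY: "Y m ((i(Suc k := j)) m) \<in> carrier_mat (q (m - 1)) (q m)"
        if "k < m" "m \<le> k + Suc (d - Suc k)" for m
        using that le[of m] step.hyps assms(3,4)[of m "(i(Suc k := j)) m"]
        by (auto simp del: fun_upd_apply)
      have gl: "mat_chain r (\<lambda>m. Gb m ((i(Suc k := j)) m)) k (d - k) = Gb (Suc k) j * ?g i"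
        unfolding dk
        by (subst mat_chain_Suc_left, rule cGb, assumption+) (simp only: gc fun_upd_same)
      have yl: "mat_chain q (\<lambda>m. Y m ((i(Suc k := j)) m)) k (d - k) = Y (Suc k) j * ?y i"
        unfolding dk
        by (subst mat_chain_Suc_left, rule cY, assumption+) (simp only: gc fun_upd_same)
      have "?g i \<in> carrier_mat (r (Suc k)) (r (Suc k + (d - Suc k)))"
        "?y i \<in> carrier_mat (q (Suc k)) (q (Suc k + (d - Suc k)))"
        using assms(3,4) i' step.hyps by (auto intro!: mat_chain_carrier)
      then have c: "?g i \<in> carrier_mat (r (Suc k)) 1" "?y i \<in> carrier_mat (q (Suc k)) 1"
        using assms(1,2) step.hyps by auto
      show ?thesis
        unfolding gl yl
        using index_mult_mat_sum[OF dG[OF j] c(1), of a 0] index_mult_mat_sum[OF dY[OF j] c(2), of x 0] step.prems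
        by (simp add: sum_product mult_ac)
    qed
    then have "(\<Sum>i\<in>?I. mat_chain r (\<lambda>m. Gb m ((i(Suc k := j)) m)) k (d - k) $$ (a, 0) *
        mat_chain q (\<lambda>m. Y m ((i(Suc k := j)) m)) k (d - k) $$ (x, 0)) / ?N =
        (\<Sum>i\<in>?I. \<Sum>a'<r (Suc k). \<Sum>x'<q (Suc k).
          Gb (Suc k) j $$ (a, a') * (?g i $$ (a', 0) * ?y i $$ (x', 0)) * Y (Suc k) j $$ (x, x')) / ?N"
      by (intro arg_cong2[where f = "(/)"] sum.cong refl) auto
    also have "\<dots> = (\<Sum>a'<r (Suc k). \<Sum>x'<q (Suc k). Gb (Suc k) j $$ (a, a') *
        (\<Sum>i\<in>?I. ?g i $$ (a', 0) * ?y i $$ (x', 0)) * Y (Suc k) j $$ (x, x')) / ?N"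
      by (subst sum.swap, intro arg_cong2[where f = "(/)"] sum.cong refl, subst sum.swap)
        (simp add: sum_distrib_left sum_distrib_right)
    also have "\<dots> = (\<Sum>a'<r (Suc k). \<Sum>x'<q (Suc k). Gb (Suc k) j $$ (a, a') * ?R $$ (a', x') * Y (Suc k) j $$ (x, x'))"
      by (simp add: IH sum_divide_distrib sum_distrib_left sum_distrib_right)
    also have "\<dots> = (Gb (Suc k) j * ?R * transpose_mat (Y (Suc k) j)) $$ (a, x)"
      using dY[OF j] step.prems
      by (subst index_mult_mat_sum3[OF dG[OF j] R, where p = "q k"]) simp_all
    finally show ?thesis by (rule sym)
  qed
  have ins: "{k<..d} = insert (Suc k) {Suc k<..d}" using step.hyps by auto
  show ?case
    using step.hyps step.prems unfolding ins
    by (subst sum_multi_idx_insert, simp, simp, subst right_interface.simps)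
      (simp add: mat_sum_def main sum_divide_distrib mult.commute del: mat_chain.simps)
qed


section \<open>The compressed residual\<close>

text \<open>The delta in \<open>Psi_mat\<close> keeps only the rows whose digit at \<open>s\<close>
  equals \<open>j\<close>, leaving the environment entries summed against \<open>\<rho>\<close> over
  all other digits. The form of \<open>\<rho>\<close> does not enter yet.\<close>

lemma compressed_residual_entry:
  assumes s: "s \<in> {1..d}" and j: "j < n s" and a: "a < r (s - 1)" and b: "b < r s"
    and dim: "dim_vec \<rho> = (\<Prod>m\<in>{1..d}. n m)"
  shows "compressed_residual d n r Gb s \<rho> $ ((j * r (s - 1) + a) * r s + b) =
    (\<Sum>i\<in>multi_idx ({1..d} - {s}) n. mat_chain r (\<lambda>m. Gb m (i m)) 0 (s - 1) $$ (0, a) *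
      mat_chain r (\<lambda>m. Gb m (i m)) s (d - s) $$ (b, 0) * \<rho> $ lex_pos {1..d} n (i(s := j)))
    / real (\<Prod>m\<in>{1..d}. n m)"
proof -
  let ?N = "\<Prod>m\<in>{1..d}. n m" and ?c = "(j * r (s - 1) + a) * r s + b" and ?P = "Psi_mat d n r Gb s"
  let ?I = "multi_idx ({1..d} - {s}) n"
  let ?E = "\<lambda>i. mat_chain r (\<lambda>m. Gb m (i m)) 0 (s - 1) $$ (0, a) *
      mat_chain r (\<lambda>m. Gb m (i m)) s (d - s) $$ (b, 0)"
  have c: "?c < n s * r (s - 1) * r s"
    by (intro pair_index_less j a b)
  have "compressed_residual d n r Gb s \<rho> $ ?c = (\<Sum>p<?N. ?P $$ (p, ?c) * \<rho> $ p) / real ?N"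
    using c dim by (simp add: compressed_residual_def Psi_mat_def[of d n r Gb s] scalar_prod_def atLeast0LessThan)
  also have "(\<Sum>p<?N. ?P $$ (p, ?c) * \<rho> $ p) =
      (\<Sum>i\<in>multi_idx {1..d} n. ?P $$ (lex_pos {1..d} n i, ?c) * \<rho> $ lex_pos {1..d} n i)"
    by (rule sum.reindex_bij_betw[symmetric]) (simp add: bij_betw_lex_pos)
  \<comment> \<open>Isolates the digit at \<open>s\<close>, so that the delta acts on the outer sum
    alone.\<close>
  also have "multi_idx {1..d} n = multi_idx (insert s ({1..d} - {s})) n"
    using s by (simp add: insert_absorb)
  also have "(\<Sum>i\<in>\<dots>. ?P $$ (lex_pos {1..d} n i, ?c) * \<rho> $ lex_pos {1..d} n i) =
      (\<Sum>j'<n s. \<Sum>i\<in>?I. ?P $$ (lex_pos {1..d} n (i(s := j')), ?c) * \<rho> $ lex_pos {1..d} n (i(s := j')))"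
    by (rule sum_multi_idx_insert) auto
  also have "\<dots> = (\<Sum>j'<n s. if j' = j then \<Sum>i\<in>?I. ?E i * \<rho> $ lex_pos {1..d} n (i(s := j)) else 0)"
  proof (rule sum.cong[OF refl])
    fix j' assume j': "j' \<in> {..<n s}"
    have "?P $$ (lex_pos {1..d} n (i(s := j')), ?c) = (if j' = j then ?E i else 0)" if i: "i \<in> ?I" for i
    proof -
      have i1: "\<forall>m\<in>{1..d}. (i(s := j')) m < n m" "\<forall>m\<in>{1..d} - {s}. (i(s := j')) m < n m"
        using i j' by (auto simp: PiE_iff)
      \<comment> \<open>The two chains cover the factors up to \<open>s - 1\<close> and those from
        \<open>s + 1\<close> on, so setting the digit at \<open>s\<close> leaves both
        unchanged.\<close>
      have "mat_chain r (\<lambda>m. Gb m ((i(s := j')) m)) 0 (s - 1) = mat_chain r (\<lambda>m. Gb m (i m)) 0 (s - 1)"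
        "mat_chain r (\<lambda>m. Gb m ((i(s := j')) m)) s (d - s) = mat_chain r (\<lambda>m. Gb m (i m)) s (d - s)"
        using s by (auto intro!: mat_chain_cong)
      then show ?thesis
        using Psi_mat_entry[OF s i1(1) j a b, of Gb] E_mat_entry[OF s i1(2) a b, of Gb]
        by (cases "j' = j") (simp_all add: fun_upd_same del: fun_upd_apply)
    qed
    then show "(\<Sum>i\<in>?I. ?P $$ (lex_pos {1..d} n (i(s := j')), ?c) * \<rho> $ lex_pos {1..d} n (i(s := j'))) =
      (if j' = j then \<Sum>i\<in>?I. ?E i * \<rho> $ lex_pos {1..d} n (i(s := j)) else 0)" by simp
  qed
  also have "\<dots> = (\<Sum>i\<in>?I. ?E i * \<rho> $ lex_pos {1..d} n (i(s := j)))"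
    using j by (simp add: sum.delta)
  finally show ?thesis .
qed

section \<open>Inserting the tensor-train form of the residual\<close>

text \<open>Cutting the chain on both sides of factor \<open>s\<close> leaves a row, the core and a
  column, because the boundary ranks are 1.\<close>

lemma mat_chain_split_entry:
  assumes s: "s \<in> {1..d}" and q: "q 0 = 1" "q d = 1"
    and F: "\<And>m. 1 \<le> m \<Longrightarrow> m \<le> d \<Longrightarrow> F m \<in> carrier_mat (q (m - 1)) (q m)"
  shows "mat_chain q F 0 d $$ (0, 0) = (\<Sum>x<q (s - 1). \<Sum>y<q s.
    mat_chain q F 0 (s - 1) $$ (0, x) * F s $$ (x, y) * mat_chain q F s (d - s) $$ (y, 0))"
proof -
  have d: "d = s + (d - s)" and s': "s = Suc (s - 1)" using s by auto
  have "mat_chain q F 0 d = mat_chain q F 0 s * mat_chain q F s (d - s)"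
    using mat_chain_add[of 0 s "d - s" F q] F s d by auto
  also have "mat_chain q F 0 s = mat_chain q F 0 (s - 1) * F s"
    using s' mat_chain.simps(2)[of q F 0 "s - 1"] by simp
  finally have 1: "mat_chain q F 0 d = mat_chain q F 0 (s - 1) * F s * mat_chain q F s (d - s)" .
  have "mat_chain q F 0 (s - 1) \<in> carrier_mat (q 0) (q (0 + (s - 1)))"
    "mat_chain q F s (d - s) \<in> carrier_mat (q s) (q (s + (d - s)))"
    using F s by (auto intro!: mat_chain_carrier)
  then have "mat_chain q F 0 (s - 1) \<in> carrier_mat 1 (q (s - 1))"
    "mat_chain q F s (d - s) \<in> carrier_mat (q s) 1"
    using q s by auto
  then show ?thesis unfolding 1 using F[of s] s by (intro index_mult_mat_sum3) auto
qed

text \<open>The purely algebraic form of the result: \<open>Gb\<close> and \<open>Y\<close> are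
  arbitrary cores of matching sizes, so the function spaces and operators enter only when this is
  instantiated.\<close>

lemma compressed_residual_eq_P_mat:
  assumes s: "s \<in> {1..d}" and r: "r 0 = 1" "r d = 1" and q: "q 0 = 1" "q d = 1"
    and dG: "\<And>m j. 1 \<le> m \<Longrightarrow> m \<le> d \<Longrightarrow> j < n m \<Longrightarrow> Gb m j \<in> carrier_mat (r (m - 1)) (r m)"
    and dY: "\<And>m j. 1 \<le> m \<Longrightarrow> m \<le> d \<Longrightarrow> j < n m \<Longrightarrow> Y m j \<in> carrier_mat (q (m - 1)) (q m)"
    and dim: "dim_vec \<rho> = (\<Prod>m\<in>{1..d}. n m)"
    and \<rho>: "\<And>i. \<forall>m\<in>{1..d}. i m < n m \<Longrightarrow>
      \<rho> $ lex_pos {1..d} n i = mat_chain q (\<lambda>m. Y m (i m)) 0 d $$ (0, 0)"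
    and j: "j < n s" and a: "a < r (s - 1)" and b: "b < r s"
  shows "compressed_residual d n r Gb s \<rho> $ ((j * r (s - 1) + a) * r s + b) =
    P_mat d n r q Gb Y s j $$ (a, b)"
proof -
  let ?S = "{1..s - 1}" and ?T = "{s<..d}"
  let ?gL = "\<lambda>i. mat_chain r (\<lambda>m. Gb m (i m)) 0 (s - 1) $$ (0, a)"
  let ?gR = "\<lambda>i. mat_chain r (\<lambda>m. Gb m (i m)) s (d - s) $$ (b, 0)"
  let ?yL = "\<lambda>i x. mat_chain q (\<lambda>m. Y m (i m)) 0 (s - 1) $$ (0, x)"
  let ?yR = "\<lambda>i y. mat_chain q (\<lambda>m. Y m (i m)) s (d - s) $$ (y, 0)"
  let ?L = "left_interface n r q Gb Y (s - 1)" and ?R = "right_interface d n r q Gb Y s"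
  let ?NS = "real (\<Prod>m\<in>?S. n m)" and ?NT = "real (\<Prod>m\<in>?T. n m)"
  have ST: "{1..d} - {s} = ?S \<union> ?T" "?S \<inter> ?T = {}" using s by auto
  \<comment> \<open>The normalization splits into the factor in \<open>P_mat\<close> and one factor
    for each interface.\<close>
  have N: "real (\<Prod>m\<in>{1..d}. n m) = real (n s) * (?NS * ?NT)"
    using s ST by (simp add: prod.remove[of _ s] prod.union_disjoint)
  have dYs: "Y s j \<in> carrier_mat (q (s - 1)) (q s)" using dY[of s j] s j by simp
  have dL: "?L \<in> carrier_mat (r (s - 1)) (q (s - 1))" by (rule left_interface_carrier[where r = r and q = q, OF r(1) q(1)])
  have dR: "?R \<in> carrier_mat (r s) (q s)"
    using s by (intro right_interface_carrier[of r d q, OF r(2) q(2)]) auto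
  have L: "?L $$ (a, x) = (\<Sum>i\<in>multi_idx ?S n. ?gL i * ?yL i x) / ?NS" if "x < q (s - 1)" for x
    using left_interface_entry[of r q "s - 1" n Gb Y a x] r q dG dY a s that by auto
  have R: "?R $$ (b, y) = (\<Sum>i\<in>multi_idx ?T n. ?gR i * ?yR i y) / ?NT" if "y < q s" for y
    using right_interface_entry[of r d q n Gb Y s b y] r q dG dY b s that by auto
  have res: "\<rho> $ lex_pos {1..d} n (i(s := j)) =
      (\<Sum>x<q (s - 1). \<Sum>y<q s. ?yL i x * Y s j $$ (x, y) * ?yR i y)"
    if i: "i \<in> multi_idx ({1..d} - {s}) n" for i
  proof -
    have le: "\<forall>m\<in>{1..d}. (i(s := j)) m < n m" using i j by (auto simp: PiE_iff)
    have "mat_chain q (\<lambda>m. Y m ((i(s := j)) m)) 0 (s - 1) = mat_chain q (\<lambda>m. Y m (i m)) 0 (s - 1)"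
      "mat_chain q (\<lambda>m. Y m ((i(s := j)) m)) s (d - s) = mat_chain q (\<lambda>m. Y m (i m)) s (d - s)"
      using s by (auto intro!: mat_chain_cong)
    moreover have "Y m ((i(s := j)) m) \<in> carrier_mat (q (m - 1)) (q m)" if "1 \<le> m" "m \<le> d" for m
      using le that by (intro dY) auto
    ultimately show ?thesis
      using \<rho>[OF le] mat_chain_split_entry[of s d q "\<lambda>m. Y m ((i(s := j)) m)"] s q
      by (simp add: fun_upd_same del: fun_upd_apply)
  qed
  \<comment> \<open>This fact and the next are the locality conditions of
    \<open>sum_multi_idx_union\<close>: the left product sees only digits before \<open>s\<close>,
    the right product only digits after \<open>s\<close>.\<close>
  have gL: "?gL i * ?yL i x = ?gL i' * ?yL i' x" if "\<And>m. m \<in> ?S \<Longrightarrow> i m = i' m" for i i' x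
    using that by (intro arg_cong2[where f = "(*)"] arg_cong[where f = "\<lambda>M. M $$ _"] mat_chain_cong) auto
  have gR: "?gR i * ?yR i y = ?gR i' * ?yR i' y" if "\<And>m. m \<in> ?T \<Longrightarrow> i m = i' m" for i i' y
    using that s by (intro arg_cong2[where f = "(*)"] arg_cong[where f = "\<lambda>M. M $$ _"] mat_chain_cong) auto
  \<comment> \<open>For fixed bond indices the entry of \<open>Y s j\<close> is constant in
    \<open>i\<close>; the remaining factors are regrouped by side of \<open>s\<close> rather than by
    chain.\<close>
  have "(\<Sum>i\<in>multi_idx ({1..d} - {s}) n. ?gL i * ?gR i * \<rho> $ lex_pos {1..d} n (i(s := j))) =
      (\<Sum>i\<in>multi_idx ({1..d} - {s}) n. \<Sum>x<q (s - 1). \<Sum>y<q s.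
        Y s j $$ (x, y) * ((?gL i * ?yL i x) * (?gR i * ?yR i y)))"
    by (intro sum.cong refl) (simp add: res sum_distrib_left mult_ac del: One_nat_def)
  also have "\<dots> = (\<Sum>x<q (s - 1). \<Sum>y<q s. Y s j $$ (x, y) *
      (\<Sum>i\<in>multi_idx (?S \<union> ?T) n. (?gL i * ?yL i x) * (?gR i * ?yR i y)))"
    unfolding ST(1)
    by (subst sum.swap, intro sum.cong refl, subst sum.swap) (simp add: sum_distrib_left)
  also have "\<dots> = (\<Sum>x<q (s - 1). \<Sum>y<q s. Y s j $$ (x, y) *
      ((\<Sum>i\<in>multi_idx ?S n. ?gL i * ?yL i x) * (\<Sum>i\<in>multi_idx ?T n. ?gR i * ?yR i y)))"
    by (subst sum_multi_idx_union[OF finite_atLeastAtMost finite_greaterThanAtMost ST(2)],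
        rule gL, blast, rule gR, blast, rule refl)
  finally have "compressed_residual d n r Gb s \<rho> $ ((j * r (s - 1) + a) * r s + b) =
      (\<Sum>x<q (s - 1). \<Sum>y<q s. ?L $$ (a, x) * Y s j $$ (x, y) * ?R $$ (b, y)) / real (n s)"
    unfolding compressed_residual_entry[OF s j a b dim] N
    by (simp only: sum_divide_distrib[of _ "{..<q (s - 1)}"] sum_divide_distrib[of _ "{..<q s}"])
      (simp add: L R mult_ac del: One_nat_def)
  \<comment> \<open>The entry of the right interface at \<open>(b, y)\<close> is that of its
    transpose at \<open>(y, b)\<close>, so the double sum is a triple matrix product.\<close>
  also have "\<dots> = P_mat d n r q Gb Y s j $$ (a, b)"
    using index_mult_mat_sum3[OF dL dYs, of "transpose_mat ?R" "r s" a b] dL dYs dR a b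
    by (simp add: P_mat_def)
  finally show ?thesis .
qed

text \<open>Counted from 0, \<open>(i * r (s - 1) + a) * r s + b\<close> is the lexicographic
  position of the triple \<open>(i, a, b)\<close> with radices \<open>n s\<close>,
  \<open>r (s - 1)\<close> and \<open>r s\<close>. The algebraic identity is applied with
  \<open>op_core\<close> as operator cores, whose sizes hold by construction.\<close>

theorem proposition4p7:
  fixes d RA :: nat
    and D :: "nat \<Rightarrow> real set"
    and H :: "nat \<Rightarrow> (real \<Rightarrow> real) set"
    and ip :: "nat \<Rightarrow> (real \<Rightarrow> real) \<Rightarrow> (real \<Rightarrow> real) \<Rightarrow> real"
    and r q n :: "nat \<Rightarrow> nat"
    and G :: "nat \<Rightarrow> real \<Rightarrow> real mat"
    and A :: "nat \<Rightarrow> nat \<Rightarrow> (real \<Rightarrow> real) \<Rightarrow> (real \<Rightarrow> real)"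
    and z :: "nat \<Rightarrow> nat \<Rightarrow> real"
    and f :: "(nat \<Rightarrow> real) \<Rightarrow> real"
    and Y :: "nat \<Rightarrow> nat \<Rightarrow> real mat"
  assumes d_pos: "1 \<le> d"
    and domain: "\<forall>m\<in>{1..d}. \<exists>lo hi. lo < hi \<and> D m = {lo<..<hi}"
    and hilbert: "\<forall>m\<in>{1..d}. hilbert_in_L2 (D m) (H m) (ip m)"
    and r_bounds: "r 0 = 1" "r d = 1" "\<forall>m\<in>{0..d}. 1 \<le> r m"
    and core_dims: "\<forall>m\<in>{1..d}. \<forall>x\<in>D m. G m x \<in> carrier_mat (r (m - 1)) (r m)"
    and core_entries: "\<forall>m\<in>{1..d}. \<forall>a<r (m - 1). \<forall>b<r m. (\<lambda>x. G m x $$ (a, b)) \<in> H m"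
    and operators: "\<forall>\<beta>\<in>{1..RA}. \<forall>m\<in>{1..d}. bounded_linear_to_L2 (D m) (H m) (ip m) (A \<beta> m)"
    and op_cores_continuous: "\<forall>\<beta>\<in>{1..RA}. \<forall>m\<in>{1..d}. \<forall>a<r (m - 1). \<forall>b<r m.
          has_cont_rep (lebesgue_on (D m)) (A \<beta> m (\<lambda>x. G m x $$ (a, b)))"
    and grid: "\<forall>m\<in>{1..d}. 1 \<le> n m \<and> (\<forall>j<n m. z m j \<in> D m)"
    and q_bounds: "q 0 = 1" "q d = 1" "\<forall>m\<in>{0..d}. 1 \<le> q m"
    and Y_dims: "\<forall>m\<in>{1..d}. \<forall>j<n m. Y m j \<in> carrier_mat (q (m - 1)) (q m)"
    and residual_tt: "\<forall>i. (\<forall>m\<in>{1..d}. i m < n m) \<longrightarrow>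
          residual_vec d D H RA A r G f n z $ lex_pos {1..d} n i =
          mat_chain q (\<lambda>m. Y m (i m)) 0 d $$ (0, 0)"
  shows "\<forall>\<beta>\<in>{1..RA}. \<forall>s\<in>{1..d}.
    left_interface n r q (op_core D r A G z \<beta>) Y (s - 1) \<in> carrier_mat (r (s - 1)) (q (s - 1)) \<and>
    right_interface d n r q (op_core D r A G z \<beta>) Y s \<in> carrier_mat (r s) (q s) \<and>
    (\<forall>i<n s.
      P_mat d n r q (op_core D r A G z \<beta>) Y s i \<in> carrier_mat (r (s - 1)) (r s) \<and>
      (\<forall>a<r (s - 1). \<forall>b<r s.
        compressed_residual d n r (op_core D r A G z \<beta>) s (residual_vec d D H RA A r G f n z)
          $ ((i * r (s - 1) + a) * r s + b) =
        P_mat d n r q (op_core D r A G z \<beta>) Y s i $$ (a, b)))"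
proof (intro ballI)
  fix \<beta> s assume s: "s \<in> {1..d}"
  let ?Gb = "op_core D r A G z \<beta>"
  have dG: "?Gb m j \<in> carrier_mat (r (m - 1)) (r m)" for m j by (simp add: op_core_def)
  have L: "left_interface n r q ?Gb Y (s - 1) \<in> carrier_mat (r (s - 1)) (q (s - 1))"
    by (rule left_interface_carrier[of r q, OF r_bounds(1) q_bounds(1)])
  have R: "right_interface d n r q ?Gb Y s \<in> carrier_mat (r s) (q s)"
    using s by (intro right_interface_carrier[of r d q, OF r_bounds(2) q_bounds(2)]) auto
  have P: "P_mat d n r q ?Gb Y s i \<in> carrier_mat (r (s - 1)) (r s)" for i
    using L R by (auto simp: P_mat_def)
  have E: "compressed_residual d n r ?Gb s (residual_vec d D H RA A r G f n z)
      $ ((i * r (s - 1) + a) * r s + b) = P_mat d n r q ?Gb Y s i $$ (a, b)"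
    if "i < n s" "a < r (s - 1)" "b < r s" for i a b
  proof (rule compressed_residual_eq_P_mat[of s d r q n ?Gb Y "residual_vec d D H RA A r G f n z" i a b])
    show "Y m j \<in> carrier_mat (q (m - 1)) (q m)" if "1 \<le> m" "m \<le> d" "j < n m" for m j
      using Y_dims that by auto
    show "dim_vec (residual_vec d D H RA A r G f n z) = (\<Prod>m\<in>{1..d}. n m)"
      by (simp add: residual_vec_def)
  qed (use s r_bounds q_bounds dG residual_tt that in blast)+
  show "left_interface n r q ?Gb Y (s - 1) \<in> carrier_mat (r (s - 1)) (q (s - 1)) \<and>
    right_interface d n r q ?Gb Y s \<in> carrier_mat (r s) (q s) \<and>
    (\<forall>i<n s. P_mat d n r q ?Gb Y s i \<in> carrier_mat (r (s - 1)) (r s) \<and>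
      (\<forall>a<r (s - 1). \<forall>b<r s.
        compressed_residual d n r ?Gb s (residual_vec d D H RA A r G f n z)
          $ ((i * r (s - 1) + a) * r s + b) = P_mat d n r q ?Gb Y s i $$ (a, b)))"
    using L R P E by blast
qed

end
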